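(* Let $g\in\Sigma$, $n\geq 0$, let $t$ be a second-order ground term whose only function variable is $F$, where $F$ has arity $n$, let $h_1,\ldots,h_n\geq 0$ be non-negative integers, and let $\sigma=\{F\mapsto\lambda x_1\ldots x_n.s\}$ be a substitution such that the individual variables of $s$ are among $x_1,\ldots,x_n$ and $\mathit{occ}_\Sigma(x_i,s)=h_i$ for all $1\leq i\leq n$. Then $$\mathit{occ}_\Sigma(g,t\sigma)=\mathit{occ}_\Sigma(g,s)\cdot\mathrm{mul}[F,\overline{h_n},t]+\mathrm{cnt}[F,\overline{h_n},g,t].$$
   Context: $\Sigma$ is a signature of function symbols with fixed arities (arity $0$ symbols are constants). Terms are built from $\Sigma$, individual variables, and function variables; a function variable of arity $n$ is applied to $n$ argument terms. A second-order ground term is a term with no individual variables and containing at least one function variable, all its function variables having the same arity. $\overline{h_n}$ abbreviates $h_1,\ldots,h_n$. $\mathit{occ}_\Sigma(c,t)$ is the number of occurrences of the symbol or variable $c$ in the term $t$. In $\sigma=\{F\mapsto\lambda x_1\ldots x_n.s\}$, the term $s$ contains no function variables. $t\sigma$ is taken in $\beta$-normal form: $F(t_1,\ldots,t_n)\sigma$ is the result of simultaneously replacing each $x_i$ in $s$ by $t_i\sigma$, and $f(t_1,\ldots,t_l)\sigma=f(t_1\sigma,\ldots,t_l\sigma)$ for $f\in\Sigma$. The following are defined recursively on terms $t$ with no individual variables and no function variable other than $F$ (of arity $n$). $n$-multiplier $\mathrm{mul}[F,\overline{h_n},t]$: it is $0$ if $t$ is a constant; $\mathrm{mul}[F,\overline{h_n},f(t_1,\ldots,t_l)]=\sum_{j=1}^l\mathrm{mul}[F,\overline{h_n},t_j]$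 for $f\in\Sigma$; $\mathrm{mul}[F,\overline{h_n},F(t_1,\ldots,t_n)]=1+\sum_{i=1}^n h_i\cdot\mathrm{mul}[F,\overline{h_n},t_i]$. $n$-counter $\mathrm{cnt}[F,\overline{h_n},g,t]$ for $g\in\Sigma$: for $f\in\Sigma$ of arity $l\geq 0$, $\mathrm{cnt}[F,\overline{h_n},g,f(t_1,\ldots,t_l)]=\delta+\sum_{j=1}^l\mathrm{cnt}[F,\overline{h_n},g,t_j]$, where $\delta=1$ if $f=g$ and $\delta=0$ otherwise; $\mathrm{cnt}[F,\overline{h_n},g,F(t_1,\ldots,t_n)]=\sum_{i=1}^n h_i\cdot\mathrm{cnt}[F,\overline{h_n},g,t_i]$. *)

theory Defs
  imports Main
begin

text \<open>
  Second-order terms over function symbols \<open>'f\<close>, individual variables \<open>'x\<close> and function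
  variables \<open>'v\<close>. The generated set functions \<open>fsyms\<close>, \<open>ivars\<close>, \<open>fvars\<close> collect the symbols and
  variables of each kind that occur in a term. Arities are imposed by \<open>wf_trm\<close>.
\<close>

datatype (fsyms: 'f, ivars: 'x, fvars: 'v) trm =
    Var 'x
  | Fun 'f "('f, 'x, 'v) trm list"
  | FApp 'v "('f, 'x, 'v) trm list"

text \<open>A signature maps each of its symbols to its arity; its set of symbols is the domain.\<close>

type_synonym 'f signature = "'f \<rightharpoonup> nat"

fun wf_trm :: "'f signature \<Rightarrow> ('v \<Rightarrow> nat) \<Rightarrow> ('f, 'x, 'v) trm \<Rightarrow> bool" where
  "wf_trm \<Sigma> arity (Var x) \<longleftrightarrow> True"
| "wf_trm \<Sigma> arity (Fun f ts) \<longleftrightarrow> \<Sigma> f = Some (length ts) \<and> (\<forall>t\<in>set ts. wf_trm \<Sigma> arity t)"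
| "wf_trm \<Sigma> arity (FApp G ts) \<longleftrightarrow> arity G = length ts \<and> (\<forall>t\<in>set ts. wf_trm \<Sigma> arity t)"

definition second_order_ground ::
    "'f signature \<Rightarrow> ('v \<Rightarrow> nat) \<Rightarrow> ('f, 'x, 'v) trm \<Rightarrow> bool" where
  "second_order_ground \<Sigma> arity t \<longleftrightarrow>
     wf_trm \<Sigma> arity t \<and> ivars t = {} \<and> fvars t \<noteq> {} \<and> (\<exists>n. \<forall>G\<in>fvars t. arity G = n)"

datatype ('f, 'x, 'v) symb = Sym 'f | IVar 'x | FVar 'v

fun occ :: "('f, 'x, 'v) symb \<Rightarrow> ('f, 'x, 'v) trm \<Rightarrow> nat" where
  "occ c (Var x) = (if c = IVar x then 1 else 0)"
| "occ c (Fun f ts) = (if c = Sym f then 1 else 0) + sum_list (map (occ c) ts)"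
| "occ c (FApp G ts) = (if c = FVar G then 1 else 0) + sum_list (map (occ c) ts)"

fun inst :: "('x \<rightharpoonup> ('f, 'x, 'v) trm) \<Rightarrow> ('f, 'x, 'v) trm \<Rightarrow> ('f, 'x, 'v) trm" where
  "inst \<theta> (Var x) = (case \<theta> x of None \<Rightarrow> Var x | Some u \<Rightarrow> u)"
| "inst \<theta> (Fun f ts) = Fun f (map (inst \<theta>) ts)"
| "inst \<theta> (FApp G ts) = FApp G (map (inst \<theta>) ts)"

text \<open>
  A substitution for function variables: \<open>\<sigma> F = Some (xs, s)\<close> stands for
  \<open>F \<mapsto> \<lambda>xs. s\<close>. Its application returns the \<open>\<beta>\<close>-normal form directly, which is correct
  because the bodies \<open>s\<close> contain no function variables.
\<close>

type_synonym ('f, 'x, 'v) fsubst = "'v \<rightharpoonup> 'x list \<times> ('f, 'x, 'v) trm"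

fun apply_fsubst :: "('f, 'x, 'v) fsubst \<Rightarrow> ('f, 'x, 'v) trm \<Rightarrow> ('f, 'x, 'v) trm" where
  "apply_fsubst \<sigma> (Var x) = Var x"
| "apply_fsubst \<sigma> (Fun f ts) = Fun f (map (apply_fsubst \<sigma>) ts)"
| "apply_fsubst \<sigma> (FApp G ts) =
     (case \<sigma> G of
        None \<Rightarrow> FApp G (map (apply_fsubst \<sigma>) ts)
      | Some (xs, s) \<Rightarrow> inst (map_of (zip xs (map (apply_fsubst \<sigma>) ts))) s)"

text \<open>
  The multiplier and the counter are meant for terms without individual variables and without
  function variables other than \<open>F\<close>, where \<open>F\<close> has arity \<open>length hs\<close>; the value \<open>0\<close> for
  \<open>Var x\<close> and for \<open>G \<noteq> F\<close> is arbitrary. The value \<open>0\<close> of the multiplier on a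
  constant \<open>Fun c []\<close> is the empty sum.
\<close>

fun mul :: "'v \<Rightarrow> nat list \<Rightarrow> ('f, 'x, 'v) trm \<Rightarrow> nat" where
  "mul F hs (Var x) = 0"
| "mul F hs (Fun f ts) = sum_list (map (mul F hs) ts)"
| "mul F hs (FApp G ts) =
     (if G = F then 1 + (\<Sum>i<length hs. hs ! i * (map (mul F hs) ts ! i)) else 0)"

fun cnt :: "'v \<Rightarrow> nat list \<Rightarrow> 'f \<Rightarrow> ('f, 'x, 'v) trm \<Rightarrow> nat" where
  "cnt F hs g (Var x) = 0"
| "cnt F hs g (Fun f ts) = (if f = g then 1 else 0) + sum_list (map (cnt F hs g) ts)"
| "cnt F hs g (FApp G ts) =
     (if G = F then (\<Sum>i<length hs. hs ! i * (map (cnt F hs g) ts ! i)) else 0)"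

end

theory Submission
  imports Defs
begin

text \<open>An occurrence of \<open>g\<close> in the instantiated term comes either from a copy of
  \<open>s\<close> or from \<open>t\<close> itself. Each \<open>F\<close> in \<open>t\<close>
  produces a copy of \<open>s\<close>, and whatever lies in its i-th argument is duplicated as often
  as the i-th bound variable occurs in \<open>s\<close>, that is \<open>hs ! i\<close> times. So
  \<open>mul\<close> counts the copies of \<open>s\<close> and \<open>cnt\<close> the surviving
  copies of the symbols \<open>g\<close> of \<open>t\<close>. The proof is an induction on
  \<open>t\<close> (\<open>occ_apply_fsubst\<close>); its case for \<open>F\<close> rests on
  counting symbols after first-order instantiation (\<open>occ_inst\<close>,
  \<open>occ_inst_zip\<close>).\<close>

lemma sum_list_sum_swap:
  fixes f :: "'a \<Rightarrow> 'b \<Rightarrow> 'c::comm_monoid_add"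
  shows "(\<Sum>x\<leftarrow>xs. \<Sum>a\<in>A. f x a) = (\<Sum>a\<in>A. \<Sum>x\<leftarrow>xs. f x a)"
  by (induction xs) (simp_all add: sum.distrib)

text \<open>Each occurrence of a variable is replaced by one copy of its image. Summing over a fixed
  \<open>A\<close> instead of \<open>ivars s\<close> gives all subterms the same index set, so their
  sums add up in the induction.\<close>

lemma occ_inst:
  fixes s :: "('f, 'x, 'v) trm"
  assumes "finite A" and "ivars s \<subseteq> A"
  shows "occ (Sym g) (inst \<theta> s) =
    occ (Sym g) s + (\<Sum>x\<in>A. occ (IVar x) s * occ (Sym g) (inst \<theta> (Var x)))"
proof -
  define w where "w x = occ (Sym g) (inst \<theta> (Var x))" for x
  \<comment> \<open>Both kinds of application reduce to this additivity over argument lists.\<close>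
  have args: "(\<Sum>u\<leftarrow>us. occ (Sym g) (inst \<theta> u)) =
      (\<Sum>u\<leftarrow>us. occ (Sym g) u) + (\<Sum>x\<in>A. (\<Sum>u\<leftarrow>us. occ (IVar x) u) * w x)"
    if "\<And>u. u \<in> set us \<Longrightarrow>
      occ (Sym g) (inst \<theta> u) = occ (Sym g) u + (\<Sum>x\<in>A. occ (IVar x) u * w x)"
    for us :: "('f, 'x, 'v) trm list"
  proof -
    have "(\<Sum>u\<leftarrow>us. occ (Sym g) (inst \<theta> u)) =
        (\<Sum>u\<leftarrow>us. occ (Sym g) u + (\<Sum>x\<in>A. occ (IVar x) u * w x))"
      using that by (simp cong: map_cong)
    then show ?thesis
      by (simp add: sum_list_addf sum_list_sum_swap sum_list_mult_const)
  qed
  from assms(2) have "occ (Sym g) (inst \<theta> s) = occ (Sym g) s + (\<Sum>x\<in>A. occ (IVar x) s * w x)"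
  proof (induction s)
    case (Var y)
    have "(\<Sum>x\<in>A. occ (IVar x) (Var y :: ('f, 'x, 'v) trm) * w x) =
        (\<Sum>x\<in>A. if x = y then w x else 0)"
      by (rule sum.cong) auto
    with Var assms(1) show ?case
      by (simp add: w_def)
  next
    case (Fun f ts)
    then show ?case
      using args[of ts] by (simp add: comp_def UN_subset_iff)
  next
    case (FApp G ts)
    then show ?case
      using args[of ts] by (simp add: comp_def UN_subset_iff)
  qed
  then show ?thesis
    by (simp add: w_def)
qed

text \<open>As \<open>xs\<close> is distinct, variables correspond bijectively to positions, the
  indexing used by \<open>mul\<close> and \<open>cnt\<close>.\<close>

lemma occ_inst_zip:
  assumes "distinct xs" and "length us = length xs" and "ivars s \<subseteq> set xs"
  shows "occ (Sym g) (inst (map_of (zip xs us)) s) =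
    occ (Sym g) s + (\<Sum>i<length xs. occ (IVar (xs ! i)) s * occ (Sym g) (us ! i))"
proof -
  have "map_of (zip xs us) (xs ! i) = Some (us ! i)" if "i < length xs" for i
    using assms that by (simp add: map_of_zip_nth)
  then have "(\<Sum>x\<in>set xs. occ (IVar x) s * occ (Sym g) (inst (map_of (zip xs us)) (Var x))) =
      (\<Sum>i<length xs. occ (IVar (xs ! i)) s * occ (Sym g) (us ! i))"
    using bij_betw_nth[OF assms(1) refl refl]
    by (subst sum.reindex_bij_betw[symmetric]) (auto intro: sum.cong)
  with occ_inst[OF _ assms(3)] show ?thesis
    by simp
qed

text \<open>The inclusion \<open>fvars t \<subseteq> {F}\<close> replaces equality because subterms
  of \<open>t\<close> may lack \<open>F\<close>.\<close>

lemma occ_apply_fsubst: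
  fixes s t :: "('f, 'x, 'v) trm"
  assumes "wf_trm \<Sigma> arity t" and "ivars t = {}" and "fvars t \<subseteq> {F}"
    and "arity F = length xs" and "length hs = length xs" and "distinct xs"
    and "ivars s \<subseteq> set xs"
    and "\<And>i. i < length xs \<Longrightarrow> occ (IVar (xs ! i)) s = hs ! i"
  shows "occ (Sym g) (apply_fsubst [F \<mapsto> (xs, s)] t) =
    occ (Sym g) s * mul F hs t + cnt F hs g t"
  using assms(1-3)
proof (induction t)
  case (Var x)
  then show ?case by simp
next
  case (Fun f ts)
  have "occ (Sym g) (apply_fsubst [F \<mapsto> (xs, s)] u) = occ (Sym g) s * mul F hs u + cnt F hs g u"
    if "u \<in> set ts" for u
    using that Fun by (auto simp: UN_subset_iff simp del: fun_upd_apply)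
  then show ?case
    by (simp add: comp_def sum_list_addf sum_list_const_mult del: fun_upd_apply cong: map_cong)
next
  case (FApp G ts)
  have G: "G = F" and len: "length ts = length xs"
    using FApp.prems assms(4) by auto
  have IH: "occ (Sym g) (apply_fsubst [F \<mapsto> (xs, s)] u) = occ (Sym g) s * mul F hs u + cnt F hs g u"
    if "u \<in> set ts" for u
    using that FApp by (auto simp: UN_subset_iff simp del: fun_upd_apply)
  \<comment> \<open>The leading \<open>occ (Sym g) s\<close> is the copy of \<open>s\<close> made by
    this \<open>F\<close>; it accounts for the \<open>1\<close> in \<open>mul\<close>.\<close>
  have "occ (Sym g) (apply_fsubst [F \<mapsto> (xs, s)] (FApp G ts)) = occ (Sym g) s +
      (\<Sum>i<length xs. hs ! i * occ (Sym g) (map (apply_fsubst [F \<mapsto> (xs, s)]) ts ! i))"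
    using occ_inst_zip[OF assms(6) _ assms(7)] len assms(8) by (simp add: G)
  also have "\<dots> = occ (Sym g) s +
      (\<Sum>i<length xs. hs ! i * (occ (Sym g) s * mul F hs (ts ! i) + cnt F hs g (ts ! i)))"
    using len by (simp add: IH)
  also have "\<dots> = occ (Sym g) s * mul F hs (FApp G ts) + cnt F hs g (FApp G ts)"
    using len assms(5)
    by (simp add: G sum.distrib sum_distrib_left algebra_simps)
  finally show ?case .
qed

theorem lemma3p6:
  fixes \<Sigma> :: "'f signature" and arity :: "'v \<Rightarrow> nat"
    and g :: 'f and F :: 'v and n :: nat
    and t s :: "('f, 'x, 'v) trm"
    and hs :: "nat list" and xs :: "'x list"
    and \<sigma> :: "('f, 'x, 'v) fsubst"
  assumes "g \<in> dom \<Sigma>"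
    and "second_order_ground \<Sigma> arity t"
    and "fvars t = {F}"
    and "arity F = n"
    and "length hs = n"
    and "length xs = n" and "distinct xs"
    and "wf_trm \<Sigma> arity s" and "fvars s = {}"
    and "ivars s \<subseteq> set xs"
    and "\<And>i. i < n \<Longrightarrow> occ (IVar (xs ! i)) s = hs ! i"
    and "\<sigma> = [F \<mapsto> (xs, s)]"
  shows "occ (Sym g) (apply_fsubst \<sigma> t) = occ (Sym g) s * mul F hs t + cnt F hs g t"
  using occ_apply_fsubst[of \<Sigma> arity t F xs hs s g] assms
  by (simp add: second_order_ground_def)

end
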